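(* Let $F=f+h$ be as in the context. The sequences $\{x_k\}_{k=0}^\infty$, $\{\varphi_k(x)\}_{k=0}^\infty$ and $\{\alpha_k\}_{k=0}^\infty$ generated by the algorithm CUESA (described in the context), from any initial point $x_0\in\mathbb{R}^n$, form an Underestimate Sequence (UES) of $F$.
   Context: Setting: $F:=f+h$ on $\mathbb{R}^n$ (Euclidean norm), where $h:\mathbb{R}^n\to\mathbb{R}$ is convex (possibly nonsmooth) and $f:\mathbb{R}^n\to\mathbb{R}$ is continuously differentiable, $\mu$-strongly convex and $L$-smooth with $L>\mu>0$, i.e. for all $x,y\in\mathbb{R}^n$: $f(x)\ge f(y)+\langle\nabla f(y),x-y\rangle+\frac{\mu}{2}\|x-y\|^2$ and $f(x)\le f(y)+\langle\nabla f(y),x-y\rangle+\frac{L}{2}\|x-y\|^2$. Proximal gradient: $\mathrm{prox}_{h,L}(x):=\arg\min_u\{h(u)+\frac{L}{2}\|x-u\|^2\}$, $G_L(x):=L\left(x-\mathrm{prox}_{h,L}(x-\frac1L\nabla f(x))\right)$. For a point $x$: $x^+:=x-\frac1L G_L(x)$ and $x^{++}:=x-\frac1\mu G_L(x)$. For $x,y\in\mathbb{R}^n$ put $\varphi(x;y):=F(y^+)+\langle G_L(y),x-y\rangle+\frac{\mu}{2}\|x-y\|^2+\frac{1}{2L}\|G_L(y)\|^2$. Algorithm CUESA (run without its stopping test, so that infinite sequences are produced): given $x_0$, set $\alpha_k=\mu/L$ for all $k\ge 0$ and $\varphi_0(x):=\varphi(x;x_0)$. For $k=0,1,2,\dots$: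 set $y_k=x_k$; $x_{k+1}=x_k-\frac1L G_L(x_k)$; $\varphi_{k+1}(x):=(1-\alpha_k)\varphi_k(x)+\alpha_k\varphi(x;y_k)$. Definition (UES). A series of sequences $\{x_k\}_{k=0}^\infty\subset\mathbb{R}^n$, $\{\phi_k(x)\}_{k=0}^\infty$ (real-valued functions on $\mathbb{R}^n$, each attaining its minimum) and $\{\alpha_k\}_{k=0}^\infty$ with $\alpha_k\in(0,1)$ for all $k\ge0$ is called an Underestimate Sequence (UES) of $F$ if for all $x\in\mathbb{R}^n$ and all $k\ge0$: (i) $\phi_k(x)\le F(x)$; and (ii) $F(x_{k+1})-\phi_{k+1}^*\le(1-\alpha_k)(F(x_k)-\phi_k^* )$, where $\phi_k^*:=\min_x\phi_k(x)$. *)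

theory Defs
  imports "HOL-Analysis.Analysis"
begin

definition gradient :: "('a::euclidean_space \<Rightarrow> real) \<Rightarrow> 'a \<Rightarrow> 'a" where
  "gradient f x = (THE D. GDERIV f x :> D)"

definition continuously_differentiable :: "('a::euclidean_space \<Rightarrow> real) \<Rightarrow> bool" where
  "continuously_differentiable f \<longleftrightarrow>
     (\<forall>x. f differentiable (at x)) \<and> continuous_on UNIV (gradient f)"

definition strongly_convex :: "real \<Rightarrow> ('a::euclidean_space \<Rightarrow> real) \<Rightarrow> bool" where
  "strongly_convex \<mu> f \<longleftrightarrow>
     (\<forall>x y. f x \<ge> f y + gradient f y \<bullet> (x - y) + \<mu> / 2 * (norm (x - y))\<^sup>2)"

definition smooth_with :: "real \<Rightarrow> ('a::euclidean_space \<Rightarrow> real) \<Rightarrow> bool" where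
  "smooth_with L f \<longleftrightarrow>
     (\<forall>x y. f x \<le> f y + gradient f y \<bullet> (x - y) + L / 2 * (norm (x - y))\<^sup>2)"

(* For convex h and L > 0 the objective below has exactly one minimiser, so the choice made by
   arg_min is then determined. *)
definition prox :: "('a::euclidean_space \<Rightarrow> real) \<Rightarrow> real \<Rightarrow> 'a \<Rightarrow> 'a" where
  "prox h L x = arg_min (\<lambda>u. h u + L / 2 * (norm (x - u))\<^sup>2) (\<lambda>_. True)"

definition prox_gradient ::
    "('a::euclidean_space \<Rightarrow> real) \<Rightarrow> ('a \<Rightarrow> real) \<Rightarrow> real \<Rightarrow> 'a \<Rightarrow> 'a" where
  "prox_gradient f h L x = L *\<^sub>R (x - prox h L (x - (1 / L) *\<^sub>R gradient f x))"

(* The point written x^+ in the literature. *)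
definition short_step ::
    "('a::euclidean_space \<Rightarrow> real) \<Rightarrow> ('a \<Rightarrow> real) \<Rightarrow> real \<Rightarrow> 'a \<Rightarrow> 'a" where
  "short_step f h L x = x - (1 / L) *\<^sub>R prox_gradient f h L x"

(* lower_model f h \<mu> L x y is the value at x of the quadratic built at the point y; it is
   usually written with a semicolon, \<phi>(x; y). *)
definition lower_model ::
    "('a::euclidean_space \<Rightarrow> real) \<Rightarrow> ('a \<Rightarrow> real) \<Rightarrow> real \<Rightarrow> real \<Rightarrow> 'a \<Rightarrow> 'a \<Rightarrow> real" where
  "lower_model f h \<mu> L x y =
     (f (short_step f h L y) + h (short_step f h L y))
     + prox_gradient f h L y \<bullet> (x - y)
     + \<mu> / 2 * (norm (x - y))\<^sup>2
     + 1 / (2 * L) * (norm (prox_gradient f h L y))\<^sup>2"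

definition cuesa_alpha :: "real \<Rightarrow> real \<Rightarrow> nat \<Rightarrow> real" where
  "cuesa_alpha \<mu> L k = \<mu> / L"

primrec cuesa_x ::
    "('a::euclidean_space \<Rightarrow> real) \<Rightarrow> ('a \<Rightarrow> real) \<Rightarrow> real \<Rightarrow> 'a \<Rightarrow> nat \<Rightarrow> 'a" where
  "cuesa_x f h L x0 0 = x0"
| "cuesa_x f h L x0 (Suc k) =
     cuesa_x f h L x0 k - (1 / L) *\<^sub>R prox_gradient f h L (cuesa_x f h L x0 k)"

definition cuesa_y ::
    "('a::euclidean_space \<Rightarrow> real) \<Rightarrow> ('a \<Rightarrow> real) \<Rightarrow> real \<Rightarrow> 'a \<Rightarrow> nat \<Rightarrow> 'a" where
  "cuesa_y f h L x0 k = cuesa_x f h L x0 k"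

primrec cuesa_phi ::
    "('a::euclidean_space \<Rightarrow> real) \<Rightarrow> ('a \<Rightarrow> real) \<Rightarrow> real \<Rightarrow> real \<Rightarrow> 'a \<Rightarrow> nat \<Rightarrow> 'a \<Rightarrow> real" where
  "cuesa_phi f h \<mu> L x0 0 = (\<lambda>x. lower_model f h \<mu> L x x0)"
| "cuesa_phi f h \<mu> L x0 (Suc k) =
     (\<lambda>x. (1 - cuesa_alpha \<mu> L k) * cuesa_phi f h \<mu> L x0 k x
          + cuesa_alpha \<mu> L k * lower_model f h \<mu> L x (cuesa_y f h L x0 k))"

definition attains_min :: "('a \<Rightarrow> real) \<Rightarrow> bool" where
  "attains_min \<phi> \<longleftrightarrow> (\<exists>z. \<forall>x. \<phi> z \<le> \<phi> x)"

(* Meaningful only under attains_min, which UES requires of every function involved. *)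
definition min_value :: "('a \<Rightarrow> real) \<Rightarrow> real" where
  "min_value \<phi> = (LEAST v. v \<in> range \<phi>)"

definition UES ::
    "('a::euclidean_space \<Rightarrow> real) \<Rightarrow> (nat \<Rightarrow> 'a) \<Rightarrow> (nat \<Rightarrow> 'a \<Rightarrow> real) \<Rightarrow> (nat \<Rightarrow> real) \<Rightarrow> bool" where
  "UES F x \<phi> \<alpha> \<longleftrightarrow>
     (\<forall>k. attains_min (\<phi> k)) \<and>
     (\<forall>k. 0 < \<alpha> k \<and> \<alpha> k < 1) \<and>
     (\<forall>k z. \<phi> k z \<le> F z) \<and>
     (\<forall>k. F (x (Suc k)) - min_value (\<phi> (Suc k)) \<le> (1 - \<alpha> k) * (F (x k) - min_value (\<phi> k)))"

end

theory Submission imports Defs begin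

text \<open>
  Two facts carry the argument.

  The first is that every model \<open>\<phi>(\<cdot>; y)\<close> lies below \<open>F\<close> (\<open>lower_model_le_objective\<close>). Write
  \<open>u = y\<^sup>+\<close> and \<open>G = G\<^sub>L(y)\<close>. Since \<open>u\<close> minimises the proximal objective, \<open>G - \<nabla>f(y)\<close> is a
  subgradient of \<open>h\<close> at \<open>u\<close>. Bounding \<open>f(x)\<close> from below by strong convexity at \<open>y\<close>, \<open>h(x)\<close> from
  below by this subgradient, and \<open>f(u)\<close> from above by smoothness at \<open>y\<close>, the gradient of \<open>f\<close>
  cancels and the model remains. As \<open>\<phi>\<^sub>k\<close> is a convex combination of such models, it lies below
  \<open>F\<close> as well. Because \<open>prox\<close> is a choice of minimiser, this requires that one exists:
  a finite convex function decreases at most linearly, so adding a quadratic makes it coercive.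

  The second is that all \<open>\<phi>\<^sub>k\<close> are paraboloids \<open>c + \<mu>/2 \<parallel>x - v\<parallel>\<^sup>2\<close> of the same curvature, so that
  minima are attained, and that the minimum of a sum is at least the sum of the minima.
  Completing the square, the minimum of \<open>\<phi>(\<cdot>; y)\<close> is
  \<open>F(y\<^sup>+) - (1/\<mu> - 1/L) \<parallel>G\<parallel>\<^sup>2/2\<close>, so with \<open>\<alpha> = \<mu>/L\<close>
  \<open>\<phi>\<^sub>k\<^sub>+\<^sub>1\<^sup>* \<ge> (1 - \<alpha>) \<phi>\<^sub>k\<^sup>* + \<alpha> F(x\<^sub>k\<^sub>+\<^sub>1) - (1 - \<alpha>) \<parallel>G\<parallel>\<^sup>2/(2L)\<close>, where \<open>G = G\<^sub>L(x\<^sub>k)\<close>.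
  The contraction of the gap thus reduces to \<open>F(x\<^sub>k\<^sub>+\<^sub>1) + \<parallel>G\<parallel>\<^sup>2/(2L) \<le> F(x\<^sub>k)\<close>. This is
  once more the lower bound, evaluated where \<open>x = y = x\<^sub>k\<close>; the choice \<open>\<alpha> = \<mu>/L\<close> is what makes
  the two coefficients of \<open>\<parallel>G\<parallel>\<^sup>2\<close> match.
\<close>

section \<open>The proximal operator of a convex function\<close>

text \<open>
  Convexity along the ray from \<open>w\<close> turns a lower bound on the unit ball into an at most
  linear decrease outside it; this gives coercivity of the proximal objective without separation
  theorems.
\<close>
lemma convex_at_most_linear_decrease:
  fixes h :: "'a::real_normed_vector \<Rightarrow> real"
  assumes h: "convex_on UNIV h"
    and m: "\<And>v. norm (v - w) \<le> 1 \<Longrightarrow> m \<le> h v"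
    and r: "1 \<le> norm (u - w)"
  shows "h w - norm (u - w) * (h w - m) \<le> h u"
proof -
  define r where "r = norm (u - w)"
  define v where "v = w + (1 / r) *\<^sub>R (u - w)"
  have r1: "1 \<le> r" using r by (simp add: r_def)
  have "norm (v - w) = 1" using r1 by (auto simp: v_def r_def)
  then have "m \<le> h v" using m by simp
  also have "v = (1 - 1 / r) *\<^sub>R w + (1 / r) *\<^sub>R u"
    by (simp add: v_def algebra_simps)
  also have "h \<dots> \<le> (1 - 1 / r) * h w + (1 / r) * h u"
    using convex_onD[OF h, of "1 / r" w u] r1 by simp
  finally have "r * m \<le> r * ((1 - 1 / r) * h w + (1 / r) * h u)"
    using r1 by (intro mult_left_mono) auto
  also have "\<dots> = (r - 1) * h w + h u"
    using r1 by (simp add: field_simps)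
  finally show ?thesis by (simp add: r_def algebra_simps)
qed

lemma proximal_objective_attains_min:
  fixes h :: "'a::euclidean_space \<Rightarrow> real"
  assumes h: "convex_on UNIV h" and L: "0 < L"
  shows "\<exists>u. \<forall>v. h u + L / 2 * (norm (w - u))\<^sup>2 \<le> h v + L / 2 * (norm (w - v))\<^sup>2"
proof -
  define p where "p = (\<lambda>u. h u + L / 2 * (norm (w - u))\<^sup>2)"
  have cont: "continuous_on S h" for S
    using convex_on_continuous[OF open_UNIV h] continuous_on_subset by blast
  obtain b where b: "\<And>v. v \<in> cball w 1 \<Longrightarrow> h b \<le> h v"
    using continuous_attains_inf[OF compact_cball _ cont, of w 1] by (auto simp del: mem_cball)
  define c where "c = h w - h b"
  \<comment> \<open>Outside this radius the quadratic term dominates the linear decrease of \<open>h\<close>.\<close>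
  define R where "R = max 1 (2 * c / L)"
  have "continuous_on (cball w R) p"
    unfolding p_def by (intro continuous_intros cont)
  then obtain u where u: "\<And>v. v \<in> cball w R \<Longrightarrow> p u \<le> p v"
    using continuous_attains_inf[OF compact_cball, of w R p]
    by (auto simp: R_def simp del: mem_cball)
  have "p u \<le> p v" for v
  proof (cases "v \<in> cball w R")
    case False
    define r where "r = norm (v - w)"
    have r: "R < r" using False by (simp add: r_def dist_norm norm_minus_commute)
    then have r1: "1 \<le> r" and rc: "2 * c / L \<le> r" by (auto simp: R_def)
    have "p u \<le> p w" using u by (simp add: R_def)
    also have "p w = h w" by (simp add: p_def)
    also have "h w \<le> (h w - r * c) + r * (L / 2 * r)"
    proof -
      have "c \<le> L / 2 * r" using rc L by (simp add: field_simps)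
      then have "r * c \<le> r * (L / 2 * r)" using r1 by (intro mult_left_mono) auto
      then show ?thesis by simp
    qed
    also have "\<dots> \<le> h v + r * (L / 2 * r)"
      using convex_at_most_linear_decrease[OF h, of w "h b" v] b r1
      by (simp add: r_def c_def dist_norm norm_minus_commute)
    also have "\<dots> = p v"
      by (simp add: p_def r_def power2_eq_square norm_minus_commute)
    finally show ?thesis .
  qed (use u in auto)
  then show ?thesis unfolding p_def by blast
qed

lemma prox_minimises:
  fixes h :: "'a::euclidean_space \<Rightarrow> real"
  assumes "convex_on UNIV h" and "0 < L"
  shows "h (prox h L w) + L / 2 * (norm (w - prox h L w))\<^sup>2 \<le> h v + L / 2 * (norm (w - v))\<^sup>2"
proof -
  let ?p = "\<lambda>u. h u + L / 2 * (norm (w - u))\<^sup>2"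
  obtain u where "\<And>v. ?p u \<le> ?p v"
    using proximal_objective_attains_min[OF assms] by blast
  then have "is_arg_min ?p (\<lambda>_. True) u"
    by (simp add: is_arg_min_linorder)
  then have "is_arg_min ?p (\<lambda>_. True) (prox h L w)"
    unfolding prox_def arg_min_def by (rule someI)
  then show ?thesis by (simp add: is_arg_min_linorder)
qed

text \<open>
  The first-order optimality condition of the proximal problem: compare the minimiser with the
  points \<open>u + t (x - u)\<close>, divide by \<open>t\<close>, and let \<open>t\<close> tend to \<open>0\<close>.
\<close>
lemma prox_subgradient:
  fixes h :: "'a::euclidean_space \<Rightarrow> real" and w x :: 'a
  assumes h: "convex_on UNIV h" and L: "0 < L"
  defines "u \<equiv> prox h L w"
  shows "h u + L * ((w - u) \<bullet> (x - u)) \<le> h x"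
proof -
  define b where "b = L / 2 * (norm (x - u))\<^sup>2"
  define a where "a = h u + L * ((w - u) \<bullet> (x - u)) - h x"
  have bound: "a \<le> t * b" if t: "0 < t" "t \<le> 1" for t
  proof -
    have "h u + L / 2 * (norm (w - u))\<^sup>2
        \<le> h ((1 - t) *\<^sub>R u + t *\<^sub>R x) + L / 2 * (norm (w - ((1 - t) *\<^sub>R u + t *\<^sub>R x)))\<^sup>2"
      unfolding u_def by (rule prox_minimises[OF h L])
    also have "h ((1 - t) *\<^sub>R u + t *\<^sub>R x) \<le> (1 - t) * h u + t * h x"
      using convex_onD[OF h, of t u x] t by simp
    also have "w - ((1 - t) *\<^sub>R u + t *\<^sub>R x) = (w - u) - t *\<^sub>R (x - u)"
      by (simp add: algebra_simps)
    also have "(norm \<dots>)\<^sup>2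
        = (norm (w - u))\<^sup>2 - 2 * t * ((w - u) \<bullet> (x - u)) + t\<^sup>2 * (norm (x - u))\<^sup>2"
      unfolding power2_norm_eq_inner inner_diff_left[of "w - u"] inner_diff_right[of _ "w - u"]
      by (simp add: inner_commute power2_eq_square)
    finally have "t * a \<le> t * (t * b)"
      by (simp add: a_def b_def power2_eq_square algebra_simps)
    then show ?thesis using t by simp
  qed
  have "((\<lambda>t. t * b) \<longlongrightarrow> 0 * b) (at_right 0)"
    by (intro tendsto_intros)
  moreover have "eventually (\<lambda>t::real. a \<le> t * b) (at_right 0)"
    unfolding eventually_at_right_field using bound by (intro exI[of _ 1]) auto
  ultimately have "a \<le> 0 * b"
    by (rule tendsto_lowerbound) simp
  then show ?thesis by (simp add: a_def)
qed

section \<open>The model as a lower bound\<close>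

text \<open>
  With \<open>u = y\<^sup>+\<close> and \<open>G = G\<^sub>L(y)\<close>, the subgradient of \<open>h\<close> at \<open>u\<close> is \<open>G - \<nabla>f(y)\<close>, so all terms in
  \<open>\<nabla>f(y)\<close> cancel. Since \<open>y - u = G/L\<close>, the term \<open>\<langle>G, y - u\<rangle> = \<parallel>G\<parallel>\<^sup>2/L\<close> exceeds the smoothness
  error \<open>\<parallel>G\<parallel>\<^sup>2/(2L)\<close> by just the constant that the model contains.
\<close>
lemma lower_model_le_objective:
  fixes f h :: "'a::euclidean_space \<Rightarrow> real"
  assumes L: "0 < L" and sc: "strongly_convex \<mu> f" and sm: "smooth_with L f"
    and h: "convex_on UNIV h"
  shows "lower_model f h \<mu> L x y \<le> f x + h x"
proof -
  define g where "g = gradient f y"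
  define G where "G = prox_gradient f h L y"
  define u where "u = short_step f h L y"
  have u_prox: "u = prox h L (y - (1 / L) *\<^sub>R g)"
    using L by (simp add: u_def short_step_def prox_gradient_def g_def)
  have u: "u = y - (1 / L) *\<^sub>R G"
    by (simp add: u_def short_step_def G_def)
  have "L *\<^sub>R (y - (1 / L) *\<^sub>R g - u) = G - g"
    using L by (simp add: u algebra_simps)
  then have "L * ((y - (1 / L) *\<^sub>R g - u) \<bullet> (x - u)) = (G - g) \<bullet> (x - u)"
    by (metis inner_scaleR_left)
  then have h_lower: "h u + (G - g) \<bullet> (x - u) \<le> h x"
    using prox_subgradient[OF h L, of "y - (1 / L) *\<^sub>R g" x] by (simp add: u_prox)
  have f_lower: "f y + g \<bullet> (x - y) + \<mu> / 2 * (norm (x - y))\<^sup>2 \<le> f x"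
    using sc by (simp add: strongly_convex_def g_def)
  have "f u \<le> f y + g \<bullet> (u - y) + L / 2 * (norm (u - y))\<^sup>2"
    using sm by (simp add: smooth_with_def g_def)
  moreover have "L / 2 * (norm (u - y))\<^sup>2 = 1 / (2 * L) * (norm G)\<^sup>2"
    using L by (simp add: u power_divide power2_eq_square field_simps)
  moreover have "(G - g) \<bullet> (x - u) = G \<bullet> (x - y) + 1 / L * (norm G)\<^sup>2 - g \<bullet> (x - y) + g \<bullet> (u - y)"
    by (simp add: u inner_diff_left inner_diff_right power2_norm_eq_inner diff_divide_distrib)
  moreover have "1 / L * (norm G)\<^sup>2 = 2 * (1 / (2 * L) * (norm G)\<^sup>2)"
    by simp
  ultimately show ?thesis
    using h_lower f_lower unfolding lower_model_def G_def[symmetric] u_def[symmetric] by linarith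
qed

section \<open>Paraboloids of a common curvature\<close>

text \<open>Completing the square; the vertex is the long step \<open>y\<^sup>+\<^sup>+\<close>.\<close>
lemma lower_model_vertex_form:
  fixes f h :: "'a::euclidean_space \<Rightarrow> real" and \<mu> L :: real
  assumes "0 < \<mu>" and "0 < L"
  defines "G y \<equiv> prox_gradient f h L y"
  shows "lower_model f h \<mu> L x y
    = f (short_step f h L y) + h (short_step f h L y) - (1 / \<mu> - 1 / L) / 2 * (norm (G y))\<^sup>2
      + \<mu> / 2 * (norm (x - (y - (1 / \<mu>) *\<^sub>R G y)))\<^sup>2"
proof -
  have "x - (y - (1 / \<mu>) *\<^sub>R G y) = (x - y) + (1 / \<mu>) *\<^sub>R G y" by simp
  also have "(norm \<dots>)\<^sup>2 = (norm (x - y))\<^sup>2 + 2 / \<mu> * (G y \<bullet> (x - y)) + 1 / \<mu>\<^sup>2 * (norm (G y))\<^sup>2"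
    unfolding power2_norm_eq_inner inner_add_left inner_add_right
    by (simp add: inner_commute power2_eq_square)
  finally show ?thesis
    using assms(1,2) unfolding lower_model_def G_def
    by (simp add: field_simps power2_eq_square)
qed

definition paraboloid :: "real \<Rightarrow> ('a::real_inner \<Rightarrow> real) \<Rightarrow> bool" where
  "paraboloid \<mu> \<phi> \<longleftrightarrow> (\<exists>c v. \<forall>x. \<phi> x = c + \<mu> / 2 * (norm (x - v))\<^sup>2)"

lemma paraboloid_lower_model:
  fixes f h :: "'a::euclidean_space \<Rightarrow> real"
  assumes "0 < \<mu>" and "0 < L"
  shows "paraboloid \<mu> (\<lambda>x. lower_model f h \<mu> L x y)"
  unfolding paraboloid_def lower_model_vertex_form[OF assms] by blast

text \<open>
  The curvature is preserved because the weights sum to one; the vertices are averaged, and the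
  distance between them only enters the minimum value.
\<close>
lemma paraboloid_affine_combination:
  fixes \<phi> \<psi> :: "'a::real_inner \<Rightarrow> real"
  assumes "paraboloid \<mu> \<phi>" and "paraboloid \<mu> \<psi>"
  shows "paraboloid \<mu> (\<lambda>x. (1 - a) * \<phi> x + a * \<psi> x)"
proof -
  obtain c v where \<phi>: "\<And>x. \<phi> x = c + \<mu> / 2 * (norm (x - v))\<^sup>2"
    using assms(1) by (auto simp: paraboloid_def)
  obtain d w where \<psi>: "\<And>x. \<psi> x = d + \<mu> / 2 * (norm (x - w))\<^sup>2"
    using assms(2) by (auto simp: paraboloid_def)
  have square: "(1 - a) * (norm p)\<^sup>2 + a * (norm q)\<^sup>2
      = (norm ((1 - a) *\<^sub>R p + a *\<^sub>R q))\<^sup>2 + a * (1 - a) * (norm (p - q))\<^sup>2" for p q :: 'a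
    by (simp add: power2_norm_eq_inner inner_add_left inner_add_right inner_diff_left
        inner_diff_right inner_commute algebra_simps)
  define c' where "c' = (1 - a) * c + a * d + \<mu> / 2 * (a * (1 - a) * (norm (w - v))\<^sup>2)"
  define v' where "v' = (1 - a) *\<^sub>R v + a *\<^sub>R w"
  have "(1 - a) * \<phi> x + a * \<psi> x = c' + \<mu> / 2 * (norm (x - v'))\<^sup>2" for x
  proof -
    have eqs: "(1 - a) *\<^sub>R (x - v) + a *\<^sub>R (x - w) = x - v'" "(x - v) - (x - w) = w - v"
      by (simp_all add: v'_def algebra_simps)
    have "(1 - a) * \<phi> x + a * \<psi> x = (1 - a) * c + a * d
        + \<mu> / 2 * ((1 - a) * (norm (x - v))\<^sup>2 + a * (norm (x - w))\<^sup>2)"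
      unfolding \<phi> \<psi> by (simp add: field_simps)
    then show ?thesis
      unfolding square eqs c'_def by (simp add: algebra_simps)
  qed
  then show ?thesis unfolding paraboloid_def by blast
qed

lemma paraboloid_attains_min:
  assumes "0 < \<mu>" and "paraboloid \<mu> \<phi>"
  shows "attains_min \<phi>"
proof -
  obtain c v where \<phi>: "\<And>x. \<phi> x = c + \<mu> / 2 * (norm (x - v))\<^sup>2"
    using assms(2) by (auto simp: paraboloid_def)
  then have "\<phi> v \<le> \<phi> x" for x using assms(1) by simp
  then show ?thesis by (auto simp: attains_min_def)
qed

lemma min_value_eqI:
  assumes "\<And>x. \<phi> z \<le> \<phi> x"
  shows "min_value \<phi> = \<phi> z"
  unfolding min_value_def using assms by (intro Least_equality) auto

lemma min_value_le:
  assumes "attains_min \<phi>"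
  shows "min_value \<phi> \<le> \<phi> x"
  using assms min_value_eqI unfolding attains_min_def by metis

lemma le_min_valueI:
  assumes "attains_min \<phi>" and "\<And>x. b \<le> \<phi> x"
  shows "b \<le> min_value \<phi>"
  using assms min_value_eqI unfolding attains_min_def by metis

section \<open>The sequences generated by CUESA\<close>

lemma cuesa_phi_paraboloid:
  fixes f h :: "'a::euclidean_space \<Rightarrow> real"
  assumes "0 < \<mu>" and "0 < L"
  shows "paraboloid \<mu> (cuesa_phi f h \<mu> L x0 k)"
  by (induction k)
    (simp_all add: paraboloid_lower_model[OF assms] paraboloid_affine_combination)

lemma cuesa_phi_le_objective:
  fixes f h :: "'a::euclidean_space \<Rightarrow> real"
  assumes "0 < \<mu>" and "\<mu> < L" and "strongly_convex \<mu> f" and "smooth_with L f"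
    and "convex_on UNIV h"
  shows "cuesa_phi f h \<mu> L x0 k z \<le> f z + h z"
proof (induction k)
  case 0
  show ?case using lower_model_le_objective[OF _ assms(3-5), of z x0] assms(1,2) by simp
next
  case (Suc k)
  show ?case
    using Suc lower_model_le_objective[OF _ assms(3-5), of z "cuesa_y f h L x0 k"] assms(1,2)
    by (auto intro!: convex_bound_le simp: cuesa_alpha_def simp del: times_divide_eq_left)
qed

text \<open>
  The descent \<open>F(x\<^sub>k\<^sub>+\<^sub>1) + \<parallel>G\<parallel>\<^sup>2/(2L) \<le> F(x\<^sub>k)\<close>, weighted with \<open>1 - \<alpha>\<close>, pays exactly for the depth
  of the new model below \<open>F(x\<^sub>k\<^sub>+\<^sub>1)\<close>, weighted with \<open>\<alpha> = \<mu>/L\<close>.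
\<close>
lemma cuesa_gap_contraction:
  fixes f h :: "'a::euclidean_space \<Rightarrow> real" and \<mu> L :: real and x0 :: 'a
  assumes \<mu>: "0 < \<mu>" and \<mu>L: "\<mu> < L" and "strongly_convex \<mu> f" and "smooth_with L f"
    and "convex_on UNIV h"
  defines "F \<equiv> \<lambda>x. f x + h x" and "X \<equiv> cuesa_x f h L x0" and "\<Phi> \<equiv> cuesa_phi f h \<mu> L x0"
  shows "F (X (Suc k)) - min_value (\<Phi> (Suc k)) \<le> (1 - \<mu> / L) * (F (X k) - min_value (\<Phi> k))"
proof -
  have L: "0 < L" using \<mu> \<mu>L by simp
  define a where "a = \<mu> / L"
  have a: "0 < a" "a < 1" using \<mu> \<mu>L by (simp_all add: a_def)
  define G where "G = prox_gradient f h L (X k)"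
  have step: "short_step f h L (X k) = X (Suc k)"
    by (simp add: short_step_def X_def)
  have attained: "attains_min (\<Phi> j)" for j
    unfolding \<Phi>_def by (rule paraboloid_attains_min[OF \<mu> cuesa_phi_paraboloid[OF \<mu> L]])
  have "lower_model f h \<mu> L (X k) (X k) \<le> F (X k)"
    unfolding F_def using lower_model_le_objective[OF L assms(3-5)] .
  then have descent: "F (X (Suc k)) + 1 / (2 * L) * (norm G)\<^sup>2 \<le> F (X k)"
    by (simp add: lower_model_def step F_def G_def)
  define m where "m = F (X (Suc k)) - (1 / \<mu> - 1 / L) / 2 * (norm G)\<^sup>2"
  have "(1 - a) * min_value (\<Phi> k) + a * m \<le> min_value (\<Phi> (Suc k))"
  proof (rule le_min_valueI[OF attained])
    fix x
    have "m \<le> lower_model f h \<mu> L x (X k)"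
      unfolding lower_model_vertex_form[OF \<mu> L] step m_def F_def G_def using \<mu> by simp
    then have "(1 - a) * min_value (\<Phi> k) + a * m
        \<le> (1 - a) * \<Phi> k x + a * lower_model f h \<mu> L x (X k)"
      using a min_value_le[OF attained] by (intro add_mono mult_left_mono) auto
    then show "(1 - a) * min_value (\<Phi> k) + a * m \<le> \<Phi> (Suc k) x"
      by (simp add: \<Phi>_def a_def cuesa_alpha_def cuesa_y_def X_def)
  qed
  moreover have "a * m = a * F (X (Suc k)) - (1 - a) * (1 / (2 * L) * (norm G)\<^sup>2)"
    using \<mu> L by (simp add: m_def a_def field_simps)
  moreover have "(1 - a) * (F (X (Suc k)) + 1 / (2 * L) * (norm G)\<^sup>2) \<le> (1 - a) * F (X k)"
    using descent a by (intro mult_left_mono) auto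
  ultimately show ?thesis
    unfolding a_def[symmetric] by (simp add: algebra_simps)
qed

theorem theorem1:
  fixes f h F :: "real ^ 'n \<Rightarrow> real" and \<mu> L :: real and x0 :: "real ^ 'n"
  assumes "0 < \<mu>" and "\<mu> < L"
    and "continuously_differentiable f"
    and "strongly_convex \<mu> f"
    and "smooth_with L f"
    and "convex_on UNIV h"
    and "F = (\<lambda>x. f x + h x)"
  shows "UES F (cuesa_x f h L x0) (cuesa_phi f h \<mu> L x0) (cuesa_alpha \<mu> L)"
  unfolding UES_def
proof (intro conjI allI)
  have L: "0 < L" using assms(1,2) by simp
  fix k
  show "attains_min (cuesa_phi f h \<mu> L x0 k)"
    by (rule paraboloid_attains_min[OF assms(1) cuesa_phi_paraboloid[OF assms(1) L]])
  show "0 < cuesa_alpha \<mu> L k" "cuesa_alpha \<mu> L k < 1"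
    using assms(1,2) by (simp_all add: cuesa_alpha_def)
  show "cuesa_phi f h \<mu> L x0 k z \<le> F z" for z
    using cuesa_phi_le_objective assms by simp
  show "F (cuesa_x f h L x0 (Suc k)) - min_value (cuesa_phi f h \<mu> L x0 (Suc k))
      \<le> (1 - cuesa_alpha \<mu> L k) * (F (cuesa_x f h L x0 k) - min_value (cuesa_phi f h \<mu> L x0 k))"
    unfolding assms(7) cuesa_alpha_def
    by (rule cuesa_gap_contraction[OF assms(1,2,4-6)])
qed

end
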